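(* The following upper bounds hold. (1) For all integers $s\geq 2$ and $m\geq 1$, $A_{s+1,s}(m) \leq \binom{m-\lceil s/2\rceil}{\lfloor s/2\rfloor}$, where $\binom{n}{j}$ is understood to be $0$ if $n<j$. (2) $A_{5,5}(m) = O(m\log m)$ as $m\to\infty$. (3) $A_{5,6}(m) = O(m\log\log m)$ as $m\to\infty$. (4) For every integer $k\geq 7$, $A_{5,k}(m) = O\big(m\,\alpha_{\lfloor (k-1)/2\rfloor}(m)\big)$ as $m\to\infty$.
   Context: All sequences are finite. A block is a contiguous, possibly empty, segment of a sequence whose letters are pairwise distinct. A sequence is on $m$ blocks if it is given as a concatenation of $m$ consecutive blocks. An alternation of length $s$ is a sequence $abab\cdots$ of length $s$ with $a \neq b$ distinct letters. A sequence avoids alternations of length $s$ if none of its (not necessarily contiguous) subsequences is an alternation of length $s$. For positive integers $s,k,m$, $A_{s,k}(m)$ denotes the maximum number of distinct letters in a sequence on $m$ blocks that avoids alternations of length $s$ and in which every letter that occurs does so at least $k$ times (the empty sequence is allowed). The inverse Ackermann hierarchy: let $A_1(n)=2n$, and for $k\geq 2$ let $A_k(0)=1$ and $A_k(n)=A_{k-1}(A_k(n-1))$ for $n\geq 1$. Then $\alpha_k(x)=\min\{n : A_k(n)\geq x\}$ for $k \geq 1$. (These one-index functions $A_k(n)$ are unrelated to the two-index functions $A_{s,k}(m)$.) *)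

theory Defs
  imports Complex_Main "HOL-Library.Sublist" "HOL-Library.Extended_Nat" "HOL-Library.Landau_Symbols"
begin

definition on_blocks :: "nat \<Rightarrow> 'a list \<Rightarrow> bool" where
  "on_blocks m u \<longleftrightarrow>
     (\<exists>bs. length bs = m \<and> (\<forall>b\<in>set bs. distinct b) \<and> u = concat bs)"

definition alternation :: "'a \<Rightarrow> 'a \<Rightarrow> nat \<Rightarrow> 'a list" where
  "alternation a b s = map (\<lambda>i. if even i then a else b) [0..<s]"

definition avoids_alternations :: "nat \<Rightarrow> 'a list \<Rightarrow> bool" where
  "avoids_alternations s u \<longleftrightarrow> (\<forall>a b. a \<noteq> b \<longrightarrow> \<not> subseq (alternation a b s) u)"

(* Sequences are finite, so taking letters from nat loses no generality. *)
definition admissible :: "nat \<Rightarrow> nat \<Rightarrow> nat \<Rightarrow> nat list set" where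
  "admissible s k m =
     {u. on_blocks m u \<and> avoids_alternations s u \<and> (\<forall>x\<in>set u. k \<le> count_list u x)}"

(* A_{s,k}(m).  For some parameters (for instance s = 3, k = 1) the number of letters is
   unbounded and no maximum exists; the value is then \<infinity>.  A finite value is an
   attained maximum, since the empty sequence is admissible. *)
definition max_letters :: "nat \<Rightarrow> nat \<Rightarrow> nat \<Rightarrow> enat" where
  "max_letters s k m = (SUP u\<in>admissible s k m. enat (card (set u)))"

(* The hierarchy is indexed from 1; the value at index 0 is a dummy. *)
fun ack :: "nat \<Rightarrow> nat \<Rightarrow> nat" where
  "ack 0 n = 0"
| "ack (Suc 0) n = 2 * n"
| "ack (Suc (Suc k)) 0 = 1"
| "ack (Suc (Suc k)) (Suc n) = ack (Suc k) (ack (Suc (Suc k)) n)"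

definition inverse_ack :: "nat \<Rightarrow> nat \<Rightarrow> nat" where
  "inverse_ack k x = (LEAST n. x \<le> ack k n)"

end

theory Submission
  imports Defs "HOL-Real_Asymp.Real_Asymp"
begin

text \<open>
  If two letters both occur in each of s consecutive disjoint groups of blocks, choosing letters
  alternately, with both letters taken in the first group, gives an alternation of length s + 1.
  For part (1), record for each letter the blocks of its second, fourth, sixth (and so on)
  occurrence: two letters with the same record violate avoidance, and there are at most as many
  records as the binomial coefficient says. For s = 4 it is enough to find few triples of cuts such that the
  occurrences of every letter are separated into four nonempty groups by one of them, since two
  letters never share a triple. Passing from k to k + 2 occurrences costs O(m) new triples besides
  a coarse family on the blocks of size t and a recursion inside them. Starting from k = 3 and
  k = 4 this gives the logarithmic hierarchy.
\<close>

section \<open>Alternations from interleaved occurrences\<close>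

text \<open>Letters are distinct within a block, so the multiplicity of a letter is the number of
  its indices. The order inside a block is dropped.\<close>

definition occ :: "'a list list \<Rightarrow> 'a \<Rightarrow> nat set" where
  "occ bs x = {i. i < length bs \<and> x \<in> set (bs ! i)}"

lemma occ_subset: "occ bs x \<subseteq> {..<length bs}"
  by (auto simp: occ_def)

lemma finite_occ: "finite (occ bs x)"
  by (rule finite_subset[OF occ_subset]) simp

lemma card_occ:
  assumes "\<forall>b\<in>set bs. distinct b"
  shows "card (occ bs x) = count_list (concat bs) x"
  using assms
proof (induction bs rule: rev_induct)
  case Nil
  then show ?case by (simp add: occ_def)
next
  case (snoc b bs)
  have "occ (bs @ [b]) x = occ bs x \<union> (if x \<in> set b then {length bs} else {})"
    by (auto simp: occ_def nth_append less_Suc_eq)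
  moreover have "length bs \<notin> occ bs x"
    by (simp add: occ_def)
  moreover have "distinct b \<Longrightarrow> count_list b x = (if x \<in> set b then 1 else 0)"
    by (induction b) auto
  ultimately show ?case
    using snoc finite_occ[of bs x] by simp
qed

lemma mem_concat_take:
  assumes "i \<in> occ bs x" "i < c"
  shows "x \<in> set (concat (take c bs))"
proof -
  have "bs ! i \<in> set (take c bs)"
    using assms by (auto simp: occ_def in_set_conv_nth)
  then show ?thesis using assms(1) by (auto simp: occ_def)
qed

lemma alternation_Suc:
  "alternation x y (Suc n) = alternation x y n @ [if even n then x else y]"
  by (simp add: alternation_def)

text \<open>Each later group supplies whichever letter comes next; the first supplies both, in the
  order in which they happen to appear, hence the unordered \<open>{x, y}\<close>. The cut
  \<open>c\<close> varies so that the induction hypothesis applies to a prefix.\<close>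

lemma alternation_if_interleaved:
  assumes "\<forall>i\<le>n. p i \<in> occ bs a \<and> q i \<in> occ bs b"
    and "\<forall>i<n. max (p i) (q i) < min (p (Suc i)) (q (Suc i))"
    and "p n < c" "q n < c" "a \<noteq> b"
  shows "\<exists>x y. {x, y} = {a, b} \<and> subseq (alternation x y (Suc (Suc n))) (concat (take c bs))"
  using assms
proof (induction n arbitrary: c)
  case 0
  let ?l = "concat (take c bs)"
  have "a \<in> set ?l" "b \<in> set ?l"
    using 0 mem_concat_take by fast+
  then obtain u v where l: "?l = u @ a # v" and "b \<in> set u \<or> b \<in> set v"
    using \<open>a \<noteq> b\<close> by (metis Un_iff set_ConsD set_append split_list)
  then consider "b \<in> set u" | "b \<in> set v" by blast
  then show ?case
  proof cases
    case 1
    then have "subseq ([b] @ [a]) (u @ a # v)"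
      by (intro list_emb_append_mono) (auto simp: subseq_singleton_left)
    then show ?thesis
      by (intro exI[of _ b] exI[of _ a]) (auto simp: l alternation_def)
  next
    case 2
    then have "subseq ([] @ a # [b]) (u @ a # v)"
      by (intro list_emb_append_mono subseq_Cons2) (auto simp: subseq_singleton_left)
    then show ?thesis
      by (intro exI[of _ a] exI[of _ b]) (auto simp: l alternation_def)
  qed
next
  case (Suc n)
  \<comment> \<open>\<open>c'\<close> separates the last group from all earlier ones.\<close>
  define c' where "c' = min (p (Suc n)) (q (Suc n))"
  have "p n < c'" "q n < c'"
    using Suc.prems(2) unfolding c'_def by (auto simp: less_Suc_eq)
  then have "\<exists>x y. {x, y} = {a, b} \<and> subseq (alternation x y (Suc (Suc n))) (concat (take c' bs))"
    using Suc.prems by (intro Suc.IH) auto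
  then obtain x y where xy: "{x, y} = {a, b}"
    and sub: "subseq (alternation x y (Suc (Suc n))) (concat (take c' bs))"
    by blast
  define z where "z = (if even (Suc (Suc n)) then x else y)"
  have "z = a \<or> z = b"
    using xy by (auto simp: z_def)
  then obtain r where r: "r \<in> occ bs z" "c' \<le> r" "r < c"
    using Suc.prems unfolding c'_def by (metis le_refl min.cobounded1 min.cobounded2)
  define rest where "rest = concat (drop c' (take c bs))"
  have "concat (take c bs) = concat (take c' bs) @ rest"
    using r unfolding rest_def
    by (metis append_take_drop_id concat_append le_trans less_imp_le min.absorb1 take_take)
  moreover have "z \<in> set rest"
  proof -
    have "drop c' (take c bs) ! (r - c') = bs ! r" "r - c' < length (drop c' (take c bs))"
      using r by (auto simp: occ_def)
    then have "bs ! r \<in> set (drop c' (take c bs))"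
      by (metis nth_mem)
    then show ?thesis
      using r by (auto simp: occ_def rest_def)
  qed
  ultimately have "subseq (alternation x y (Suc (Suc n)) @ [z]) (concat (take c bs))"
    using sub by (metis list_emb_append_mono subseq_singleton_left)
  then show ?case
    using xy unfolding z_def alternation_Suc[of x y "Suc (Suc n)", symmetric] by blast
qed

lemma avoids_not_interleaved:
  assumes "avoids_alternations (Suc (Suc n)) (concat bs)" "a \<noteq> b"
    and "\<forall>i\<le>n. p i \<in> occ bs a \<and> q i \<in> occ bs b"
    and "\<forall>i<n. max (p i) (q i) < min (p (Suc i)) (q (Suc i))"
  shows False
proof -
  have "p n < length bs" "q n < length bs"
    using assms(3) by (simp_all add: occ_def)
  from alternation_if_interleaved[OF assms(3,4) this assms(2)]
  obtain x y where "{x, y} = {a, b}" "subseq (alternation x y (Suc (Suc n))) (concat bs)"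
    by auto
  moreover from this(1) have "x \<noteq> y"
    using assms(2) by auto
  ultimately show False
    using assms(1) unfolding avoids_alternations_def by blast
qed

lemma max_letters_le:
  assumes "\<And>bs :: nat list list. \<lbrakk>length bs = m; avoids_alternations s (concat bs);
      \<forall>x\<in>set (concat bs). k \<le> card (occ bs x)\<rbrakk> \<Longrightarrow> card (set (concat bs)) \<le> N"
  shows "max_letters s k m \<le> enat N"
  unfolding max_letters_def
proof (rule SUP_least)
  fix u assume "u \<in> admissible s k m"
  then obtain bs where bs: "length bs = m" "\<forall>b\<in>set bs. distinct b" "u = concat bs"
    "avoids_alternations s u" "\<forall>x\<in>set u. k \<le> count_list u x"
    unfolding admissible_def on_blocks_def by blast
  then show "enat (card (set u)) \<le> enat N"
    using assms[of bs] by (simp add: card_occ)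
qed

section \<open>The binomial bound\<close>

lemma sorted_list_nth_add_le:
  fixes xs :: "nat list"
  assumes "sorted_wrt (<) xs" "i + d < length xs"
  shows "xs ! i + d \<le> xs ! (i + d)"
  using assms(2)
proof (induction d)
  case (Suc d)
  then have "xs ! (i + d) < xs ! Suc (i + d)"
    using assms(1) by (simp add: sorted_wrt_iff_nth_less)
  then show ?case using Suc by simp
qed simp

text \<open>A finite set has only one increasing enumeration. So the record of a letter may be kept
  as a set, and \<open>n_subsets\<close> counts the records.\<close>

lemma strictly_increasing_eq_if_image_eq:
  fixes f g :: "nat \<Rightarrow> nat"
  assumes "strict_mono_on {..<r} f" "strict_mono_on {..<r} g" "f ` {..<r} = g ` {..<r}" "j < r"
  shows "f j = g j"
proof -
  have "sorted_wrt (<) (map h [0..<r])" if "strict_mono_on {..<r} h" for h :: "nat \<Rightarrow> nat"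
    using that by (auto simp: sorted_wrt_iff_nth_less strict_mono_on_def)
  then have "map f [0..<r] = map g [0..<r]"
    using assms
    by (intro strict_sorted_equal) (auto simp: atLeast0LessThan)
  then show ?thesis using assms(4) by simp
qed

lemma max_letters_le_binomial:
  assumes "2 \<le> s"
  shows "max_letters (Suc s) s m \<le> enat ((m - (s - s div 2)) choose (s div 2))"
proof (rule max_letters_le)
  fix bs :: "nat list list"
  assume len: "length bs = m" and avoids: "avoids_alternations (Suc s) (concat bs)"
    and many: "\<forall>x\<in>set (concat bs). s \<le> card (occ bs x)"
  define L where "L x = sorted_list_of_set (occ bs x)" for x
  define r where "r = s div 2"
  \<comment> \<open>The recorded blocks are pairwise non-adjacent; subtracting the rank closes the gaps.\<close>
  define e where "e x j = L x ! (2 * j + 1) - Suc j" for x j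
  have sorted: "sorted_wrt (<) (L x)" and mem: "set (L x) = occ bs x" for x
    using finite_occ[of bs x] by (auto simp: L_def)
  have lenL: "s \<le> length (L x)" if "x \<in> set (concat bs)" for x
    using many that by (auto simp: L_def)
  have step: "L x ! i + d \<le> L x ! (i + d)" if "x \<in> set (concat bs)" "i + d < s" for x i d
    using sorted_list_nth_add_le[OF sorted, of i d x] lenL that by force
  have in_occ: "L x ! i \<in> occ bs x" if "x \<in> set (concat bs)" "i < s" for x i
    using mem lenL that by (metis less_le_trans nth_mem)
  have r: "2 * r \<le> s" "s \<le> 2 * r + 1" by (auto simp: r_def)
  have mono: "strict_mono_on {..<r} (e x)" if x: "x \<in> set (concat bs)" for x
  proof (rule strict_mono_onI)
    fix i j assume "i \<in> {..<r}" "j \<in> {..<r}" "i < j"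
    then have "2 * i + 1 + 2 * (j - i) < s" "0 + (2 * i + 1) < s"
      using r by auto
    note this[THEN step[OF x]]
    moreover have "2 * i + 1 + 2 * (j - i) = 2 * j + 1" using \<open>i < j\<close> by simp
    ultimately show "e x i < e x j"
      using \<open>i < j\<close> unfolding e_def by simp
  qed
  have bounded: "e x j < m - (s - r)" if x: "x \<in> set (concat bs)" and j: "j < r" for x j
  proof -
    \<comment> \<open>Of the first \<open>s\<close> occurrences, \<open>s - 2 - 2 * j\<close> come
      after this one, each in a later block of its own. Subtracting \<open>Suc j\<close> as well and
      using \<open>j < r\<close> leaves only values below \<open>m - (s - r)\<close>.\<close>
    have "L x ! (2 * j + 1) + (s - 1 - (2 * j + 1)) \<le> L x ! (2 * j + 1 + (s - 1 - (2 * j + 1)))"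
      using r j by (intro step[OF x]) auto
    also have "2 * j + 1 + (s - 1 - (2 * j + 1)) = s - 1"
      using r j by simp
    also have "L x ! (s - 1) < m"
      using in_occ[OF x, of "s - 1"] assms len by (simp add: occ_def)
    finally have "L x ! (2 * j + 1) + (s - 1 - (2 * j + 1)) < m" .
    moreover have "2 * j + 1 \<le> L x ! (2 * j + 1)"
      using r j step[OF x, of 0 "2 * j + 1"] by simp
    ultimately show ?thesis
      using r j unfolding e_def by linarith
  qed
  have "inj_on (\<lambda>x. e x ` {..<r}) (set (concat bs))"
  proof (rule inj_onI, rule ccontr)
    fix a b assume a: "a \<in> set (concat bs)" and b: "b \<in> set (concat bs)"
      and eq: "e a ` {..<r} = e b ` {..<r}" and "a \<noteq> b"
    have odd_eq: "L a ! i = L b ! i" if "odd i" "i < s" for i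
    proof -
      obtain j where j: "i = 2 * j + 1" using \<open>odd i\<close> by (rule oddE)
      then have "j < r" using r that by linarith
      then have "e a j = e b j"
        using strictly_increasing_eq_if_image_eq mono a b eq by blast
      \<comment> \<open>Both entries are at least \<open>Suc j\<close>, so the subtraction in
        \<open>e\<close> is not truncated and can be undone.\<close>
      moreover have "L a ! 0 + (2 * j + 1) \<le> L a ! (0 + (2 * j + 1))"
        "L b ! 0 + (2 * j + 1) \<le> L b ! (0 + (2 * j + 1))"
        using that j by (intro step a b; simp)+
      ultimately show ?thesis unfolding e_def j by simp
    qed
    obtain n where n: "s = Suc n" using assms by (cases s) auto
    show False
    proof (rule avoids_not_interleaved[of n bs a b "nth (L a)" "nth (L b)"])
      show "avoids_alternations (Suc (Suc n)) (concat bs)" using avoids n by simp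
      show "\<forall>i\<le>n. L a ! i \<in> occ bs a \<and> L b ! i \<in> occ bs b"
        using in_occ a b n by simp
      show "\<forall>i<n. max (L a ! i) (L b ! i) < min (L a ! Suc i) (L b ! Suc i)"
      proof (intro allI impI)
        fix i assume "i < n"
        then have "L a ! i < L a ! Suc i" "L b ! i < L b ! Suc i"
          using step[OF a, of i 1] step[OF b, of i 1] n by auto
        \<comment> \<open>One of \<open>i\<close> and \<open>Suc i\<close> is odd. The two letters
          share a block there, and strict increase separates the pair at \<open>i\<close> from the
          pair at \<open>Suc i\<close>.\<close>
        moreover have "L a ! i = L b ! i \<or> L a ! Suc i = L b ! Suc i"
          using odd_eq[of i] odd_eq[of "Suc i"] \<open>i < n\<close> n by auto
        ultimately show "max (L a ! i) (L b ! i) < min (L a ! Suc i) (L b ! Suc i)"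
          by auto
      qed
    qed (fact \<open>a \<noteq> b\<close>)
  qed
  moreover have "(\<lambda>x. e x ` {..<r}) ` set (concat bs)
      \<subseteq> {A. A \<subseteq> {..<m - (s - r)} \<and> card A = r}"
    using bounded card_image[OF strict_mono_on_imp_inj_on[OF mono]] by auto
  ultimately have "card (set (concat bs)) \<le> card {A. A \<subseteq> {..<m - (s - r)} \<and> card A = r}"
    by (intro card_inj_on_le[where f = "\<lambda>x. e x ` {..<r}"]) auto
  also have "\<dots> = (m - (s - r)) choose r"
    by (simp add: n_subsets)
  finally show "card (set (concat bs)) \<le> (m - (s - s div 2)) choose (s div 2)"
    by (simp add: r_def)
qed

section \<open>Stabbing families of triples\<close>

text \<open>An entry \<open>c\<close> stands for the cut just before position \<open>c\<close>. Thus
  \<open>x\<close> and \<open>Suc x\<close> are the cuts on either side of a point \<open>x\<close>,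
  and a stabbed set meets all four parts.\<close>

definition stabs :: "nat \<times> nat \<times> nat \<Rightarrow> nat set \<Rightarrow> bool" where
  "stabs t S \<longleftrightarrow> (\<exists>w\<in>S. \<exists>x\<in>S. \<exists>y\<in>S. \<exists>z\<in>S.
     w < fst t \<and> fst t \<le> x \<and> x < fst (snd t) \<and> fst (snd t) \<le> y \<and> y < snd (snd t) \<and> snd (snd t) \<le> z)"

lemma stabsI:
  assumes "w \<in> S" "x \<in> S" "y \<in> S" "z \<in> S"
    and "w < a" "a \<le> x" "x < b" "b \<le> y" "y < c" "c \<le> z"
  shows "stabs (a, b, c) S"
  unfolding stabs_def fst_conv snd_conv
  by (rule bexI[of _ w], rule bexI[of _ x], rule bexI[of _ y], rule bexI[of _ z])
    (simp_all add: assms)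

text \<open>Speaks of sets of positions only, without letters, so that it passes to shifted pieces
  and to sets of block indices.\<close>

definition stabbable :: "nat \<Rightarrow> nat \<Rightarrow> nat \<Rightarrow> bool" where
  "stabbable k n N \<longleftrightarrow> (\<exists>Z. finite Z \<and> card Z \<le> N \<and>
     (\<forall>S. S \<subseteq> {..<n} \<longrightarrow> k \<le> card S \<longrightarrow> (\<exists>t\<in>Z. stabs t S)))"

lemma stabbable_mono:
  assumes "stabbable k n N" "k \<le> k'" "N \<le> N'"
  shows "stabbable k' n N'"
proof -
  obtain Z where "finite Z" "card Z \<le> N"
    and Z: "\<And>S. S \<subseteq> {..<n} \<Longrightarrow> k \<le> card S \<Longrightarrow> \<exists>t\<in>Z. stabs t S"
    using assms(1) unfolding stabbable_def by blast
  moreover have "card Z \<le> N'" using \<open>card Z \<le> N\<close> assms(3) by simp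
  moreover have "\<exists>t\<in>Z. stabs t S" if "S \<subseteq> {..<n}" "k' \<le> card S" for S
    using that assms(2) by (intro Z) simp_all
  ultimately show ?thesis unfolding stabbable_def by blast
qed

lemma stabbable_small:
  assumes "n < k"
  shows "stabbable k n 0"
proof -
  have "card S < k" if "S \<subseteq> {..<n}" for S
    using card_mono[OF _ that] assms by simp
  then show ?thesis
    unfolding stabbable_def by (intro exI[of _ "{}"]) (auto simp: not_le[symmetric])
qed

text \<open>Send each letter to a triple stabbing its occurrences. Two letters with the same triple
  would both occur in all four parts and give an alternation of length 5, so this map is
  injective.\<close>

lemma max_letters_le_stabbable:
  assumes "stabbable k m N"
  shows "max_letters 5 k m \<le> enat N"
proof (rule max_letters_le)
  fix bs :: "nat list list"
  assume len: "length bs = m" and avoids: "avoids_alternations 5 (concat bs)"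
    and many: "\<forall>x\<in>set (concat bs). k \<le> card (occ bs x)"
  obtain Z where Z: "finite Z" "card Z \<le> N"
    "\<And>S. S \<subseteq> {..<m} \<Longrightarrow> k \<le> card S \<Longrightarrow> \<exists>t\<in>Z. stabs t S"
    using assms unfolding stabbable_def by blast
  have "\<forall>x\<in>set (concat bs). \<exists>t. t \<in> Z \<and> stabs t (occ bs x)"
    using Z(3)[OF occ_subset[of bs, unfolded len]] many by blast
  then obtain \<tau> where \<tau>: "\<forall>x\<in>set (concat bs). \<tau> x \<in> Z \<and> stabs (\<tau> x) (occ bs x)"
    by metis
  have "inj_on \<tau> (set (concat bs))"
  proof (rule inj_onI, rule ccontr)
    fix a b assume ab: "a \<in> set (concat bs)" "b \<in> set (concat bs)" "\<tau> a = \<tau> b" "a \<noteq> b"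
    obtain c1 c2 c3 where c: "\<tau> a = (c1, c2, c3)" by (cases "\<tau> a") auto
    then have "stabs (c1, c2, c3) (occ bs a)" "stabs (c1, c2, c3) (occ bs b)"
      using \<tau> ab by metis+
    then obtain p0 p1 p2 p3 q0 q1 q2 q3 where
      pq: "p0 \<in> occ bs a" "p1 \<in> occ bs a" "p2 \<in> occ bs a" "p3 \<in> occ bs a"
      "q0 \<in> occ bs b" "q1 \<in> occ bs b" "q2 \<in> occ bs b" "q3 \<in> occ bs b"
      "p0 < c1" "c1 \<le> p1" "p1 < c2" "c2 \<le> p2" "p2 < c3" "c3 \<le> p3"
      "q0 < c1" "c1 \<le> q1" "q1 < c2" "c2 \<le> q2" "q2 < c3" "c3 \<le> q3"
      unfolding stabs_def by auto
    show False
    proof (rule avoids_not_interleaved[of 3 bs a b "nth [p0, p1, p2, p3]" "nth [q0, q1, q2, q3]"])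
      show "avoids_alternations (Suc (Suc 3)) (concat bs)"
        using avoids by (simp add: eval_nat_numeral)
      show "\<forall>i\<le>3. [p0, p1, p2, p3] ! i \<in> occ bs a \<and> [q0, q1, q2, q3] ! i \<in> occ bs b"
        using pq by (auto simp: eval_nat_numeral le_Suc_eq)
      show "\<forall>i<3. max ([p0, p1, p2, p3] ! i) ([q0, q1, q2, q3] ! i)
          < min ([p0, p1, p2, p3] ! Suc i) ([q0, q1, q2, q3] ! Suc i)"
        using pq by (auto simp: eval_nat_numeral less_Suc_eq)
    qed (fact \<open>a \<noteq> b\<close>)
  qed
  then have "card (set (concat bs)) \<le> card Z"
    using \<tau> Z(1) by (intro card_inj_on_le[where f = \<tau>]) auto
  then show "card (set (concat bs)) \<le> N" using Z(2) by simp
qed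

section \<open>Splitting the positions into blocks of equal size\<close>

text \<open>The summand is the size of block \<open>b\<close> of \<open>{..<n}\<close>; truncation
  makes it 0 past the end. Costs linear in the block size therefore add up to a cost linear in
  \<open>n\<close>.\<close>

lemma sum_min_block: "(\<Sum>b<q. min t (n - b * t)) = min (q * t) (n :: nat)"
proof (induction q)
  case (Suc q)
  then show ?case unfolding sum.lessThan_Suc mult_Suc by linarith
qed simp

text \<open>Shift a family for each block into place. The last block may be shorter, so
  \<open>local\<close> is assumed for every size up to \<open>t\<close>.\<close>

lemma stabbable_local:
  assumes "0 < t" "n \<le> q * t" and local: "\<And>t'. t' \<le> t \<Longrightarrow> stabbable k t' (c * t')"
  shows "\<exists>Z. finite Z \<and> card Z \<le> c * n \<and>
    (\<forall>S b. S \<subseteq> {..<n} \<longrightarrow> k \<le> card S \<longrightarrow> (\<forall>x\<in>S. x div t = b) \<longrightarrow> (\<exists>t\<in>Z. stabs t S))"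
proof (cases "k = 0")
  \<comment> \<open>The empty set is never stabbed, so \<open>local\<close> is contradictory here.
    For positive \<open>k\<close> the set has a point, which gives \<open>b < q\<close>
    below.\<close>
  case True
  then show ?thesis
    using local[of 0] by (auto simp: stabbable_def stabs_def)
next
  case False
  define sz where "sz b = min t (n - b * t)" for b
  have "\<forall>b. \<exists>Z. finite Z \<and> card Z \<le> c * sz b \<and>
     (\<forall>S. S \<subseteq> {..<sz b} \<longrightarrow> k \<le> card S \<longrightarrow> (\<exists>t\<in>Z. stabs t S))"
    using local unfolding stabbable_def sz_def by simp
  then obtain Z where Z: "\<And>b. finite (Z b)" "\<And>b. card (Z b) \<le> c * sz b"
    "\<And>b S. S \<subseteq> {..<sz b} \<Longrightarrow> k \<le> card S \<Longrightarrow> \<exists>t\<in>Z b. stabs t S"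
    by metis
  define shift where "shift d = (\<lambda>(x, y, z). (x + d, y + d, z + d :: nat))" for d :: nat
  define Y where "Y = (\<Union>b<q. shift (b * t) ` Z b)"
  have "card Y \<le> (\<Sum>b<q. card (shift (b * t) ` Z b))"
    unfolding Y_def by (intro card_UN_le) simp
  also have "\<dots> \<le> (\<Sum>b<q. c * sz b)"
    by (intro sum_mono) (meson Z card_image_le order_trans)
  also have "\<dots> \<le> c * n"
    using sum_min_block[where q=q and t=t and n=n] by (simp add: sz_def flip: sum_distrib_left)
  finally have "card Y \<le> c * n" .
  moreover have "\<exists>u\<in>Y. stabs u S"
    if S: "S \<subseteq> {..<n}" "k \<le> card S" "\<forall>x\<in>S. x div t = b" for S b
  proof -
    have lo: "b * t \<le> x" and hi: "x < Suc b * t" if "x \<in> S" for x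
      using S(3) that \<open>0 < t\<close>
      by (auto simp: less_eq_div_iff_mult_less_eq[symmetric] div_less_iff_less_mult[symmetric]
          simp del: mult_Suc)
    let ?S = "(\<lambda>x. x - b * t) ` S"
    have "x - b * t < sz b" if "x \<in> S" for x
      using lo[OF that] hi[OF that] S(1) that unfolding sz_def by fastforce
    then have "?S \<subseteq> {..<sz b}" by auto
    moreover have "card ?S = card S"
      using lo by (intro card_image inj_onI) (metis le_add_diff_inverse2)
    ultimately obtain u where u: "u \<in> Z b" "stabs u ?S"
      using Z(3)[of ?S b] S(2) by auto
    have "stabs (shift (b * t) u) S"
      using u(2) lo unfolding stabs_def shift_def
      by (auto simp: less_diff_conv2 le_diff_conv2 split: prod.splits) blast
    moreover have "b < q"
    proof -
      obtain x where "x \<in> S" using S(2) False by (metis card.empty ex_in_conv le_zero_eq)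
      then have "b * t \<le> x" "x < n" using lo S(1) by auto
      then have "b * t < q * t" using assms(2) by linarith
      then show ?thesis by simp
    qed
    ultimately show ?thesis
      using u(1) unfolding Y_def by blast
  qed
  moreover have "finite Y" using Z by (auto simp: Y_def)
  ultimately show ?thesis by blast
qed

text \<open>
  Cut the ground set into q blocks of size t. A set not contained in one block is stabbed either by
  a triple of block boundaries, or, if two of its points other than the extreme ones share a
  block, by one of three triples determined by one point: two cuts next to it and a boundary of its
  block, or one cut and both boundaries. In the remaining case at least k blocks are met.
\<close>
lemma stabbable_step:
  assumes "0 < t" "n \<le> q * t" and local: "\<And>t'. t' \<le> t \<Longrightarrow> stabbable (k + 2) t' (c * t')"
    and coarse: "stabbable k q N"
  shows "stabbable (k + 2) n (c * n + 3 * n + N)"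
proof -
  obtain Z0 where Z0: "finite Z0" "card Z0 \<le> c * n"
    "\<And>S b. \<lbrakk>S \<subseteq> {..<n}; k + 2 \<le> card S; \<forall>x\<in>S. x div t = b\<rbrakk> \<Longrightarrow> \<exists>u\<in>Z0. stabs u S"
    using stabbable_local[OF assms(1,2) local] by metis
  obtain Zc where Zc: "finite Zc" "card Zc \<le> N"
    "\<And>S. S \<subseteq> {..<q} \<Longrightarrow> k \<le> card S \<Longrightarrow> \<exists>u\<in>Zc. stabs u S"
    using coarse unfolding stabbable_def by blast
  define l where "l i = (i div t) * t" for i
  define r where "r i = Suc (i div t) * t" for i
  define Z1 where "Z1 = (\<lambda>i. (i, Suc i, r i)) ` {..<n}"
  define Z2 where "Z2 = (\<lambda>i. (l i, i, Suc i)) ` {..<n}"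
  define Z3 where "Z3 = (\<lambda>i. (l i, i, r i)) ` {..<n}"
  define Z4 where "Z4 = (\<lambda>(x, y, z). (x * t, y * t, z * t)) ` Zc"
  define Z where "Z = Z0 \<union> Z1 \<union> Z2 \<union> Z3 \<union> Z4"
  have le_iff: "c * t \<le> x \<longleftrightarrow> c \<le> x div t" and less_iff: "x < c * t \<longleftrightarrow> x div t < c" for c x
    using \<open>0 < t\<close> by (simp_all add: less_eq_div_iff_mult_less_eq div_less_iff_less_mult)
  have "finite Z"
    using Z0 Zc by (auto simp: Z_def Z1_def Z2_def Z3_def Z4_def)
  moreover have "card Z \<le> c * n + 3 * n + N"
  proof -
    have "card Z1 \<le> n" "card Z2 \<le> n" "card Z3 \<le> n"
      unfolding Z1_def Z2_def Z3_def by (metis card_image_le card_lessThan finite_lessThan)+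
    moreover have "card Z4 \<le> N"
      unfolding Z4_def using card_image_le Zc order_trans by blast
    moreover have "card Z \<le> card Z0 + card Z1 + card Z2 + card Z3 + card Z4"
      unfolding Z_def by (meson add_le_mono card_Un_le le_refl order_trans)
    ultimately show ?thesis using Z0(2) by linarith
  qed
  moreover have "\<exists>u\<in>Z. stabs u S" if S: "S \<subseteq> {..<n}" "k + 2 \<le> card S" for S
  proof (cases "inj_on (\<lambda>x. x div t) (S - {Min S, Max S})")
    case True
    let ?B = "(\<lambda>x. x div t) ` S"
    have fin: "finite S" using S(1) finite_subset by blast
    have "card S - card {Min S, Max S} \<le> card (S - {Min S, Max S})"
      by (rule diff_card_le_card_Diff) simp
    moreover have "card {Min S, Max S} \<le> 2"
      by (simp add: card_insert_if)
    moreover have "card (S - {Min S, Max S}) \<le> card ?B"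
      using True fin by (intro card_inj_on_le[where f = "\<lambda>x. x div t"]) auto
    \<comment> \<open>Inner points lie in different blocks and at most two points are left out. A
      triple stabbing the set of block indices, multiplied by \<open>t\<close>, stabs
      \<open>S\<close>.\<close>
    ultimately have "k \<le> card ?B" using S(2) by linarith
    moreover have "?B \<subseteq> {..<q}"
      using S(1) assms(2) by (auto simp: less_iff[symmetric])
    ultimately obtain u where u: "u \<in> Zc" "stabs u ?B" using Zc(3) by blast
    obtain u1 u2 u3 where u123: "u = (u1, u2, u3)" by (cases u) auto
    have "stabs (u1 * t, u2 * t, u3 * t) S"
      using u(2) unfolding stabs_def u123 by (auto simp: le_iff less_iff)
    moreover have "(u1 * t, u2 * t, u3 * t) \<in> Z"
      using u(1) unfolding Z_def Z4_def u123 by force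
    ultimately show ?thesis by blast
  next
    case False
    define lo where "lo = Min S"
    define hi where "hi = Max S"
    obtain x y where "x \<in> S" "y \<in> S" "x \<noteq> lo" "y \<noteq> hi" and xy: "x < y" "x div t = y div t"
      using False unfolding inj_on_def lo_def hi_def
      by (metis Diff_iff insertCI linorder_neqE_nat)
    have fin: "finite S" using S(1) finite_subset by blast
    have "lo \<in> S" "hi \<in> S" and range: "\<forall>z\<in>S. lo \<le> z \<and> z \<le> hi"
      using \<open>x \<in> S\<close> fin by (auto simp: lo_def hi_def intro: Min_in Max_in)
    have order: "lo < x" "y < hi"
      using range \<open>x \<in> S\<close> \<open>y \<in> S\<close> \<open>x \<noteq> lo\<close> \<open>y \<noteq> hi\<close> by (auto simp: le_less)
    have div_order: "lo div t \<le> x div t" "y div t \<le> hi div t"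
      using order by (simp_all add: div_le_mono)
    have below_n: "x < n" "y < n" using S(1) \<open>x \<in> S\<close> \<open>y \<in> S\<close> by auto
    \<comment> \<open>The witnesses are \<open>lo < x < y < hi\<close>, with \<open>x\<close> and
      \<open>y\<close> in one block. The cases ask which of \<open>lo\<close> and \<open>hi\<close>
      lie in that block too: both, only \<open>lo\<close>, only \<open>hi\<close>, or
      neither.\<close>
    consider "lo div t = hi div t" | "lo div t = x div t" "x div t < hi div t"
      | "lo div t < x div t" "x div t = hi div t" | "lo div t < x div t" "x div t < hi div t"
      using div_order xy(2) by linarith
    then show ?thesis
    proof cases
      case 1
      then have "\<forall>z\<in>S. z div t = lo div t"
        using range by (metis div_le_mono le_antisym)
      then show ?thesis using Z0(3) S unfolding Z_def by blast
    next
      case 2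
      have "stabs (x, Suc x, r x) S"
        by (rule stabsI[OF \<open>lo \<in> S\<close> \<open>x \<in> S\<close> \<open>y \<in> S\<close> \<open>hi \<in> S\<close>])
          (use 2 order xy in \<open>simp_all add: r_def le_iff less_iff del: mult_Suc\<close>)
      then show ?thesis using below_n unfolding Z_def Z1_def by blast
    next
      case 3
      have "stabs (l y, y, Suc y) S"
        by (rule stabsI[OF \<open>lo \<in> S\<close> \<open>x \<in> S\<close> \<open>y \<in> S\<close> \<open>hi \<in> S\<close>])
          (use 3 order xy in \<open>simp_all add: l_def le_iff less_iff\<close>)
      then show ?thesis using below_n unfolding Z_def Z2_def by blast
    next
      case 4
      have "stabs (l y, y, r y) S"
        by (rule stabsI[OF \<open>lo \<in> S\<close> \<open>x \<in> S\<close> \<open>y \<in> S\<close> \<open>hi \<in> S\<close>])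
          (use 4 order xy in \<open>simp_all add: l_def r_def le_iff less_iff del: mult_Suc\<close>)
      then show ?thesis using below_n unfolding Z_def Z3_def by blast
    qed
  qed
  ultimately show ?thesis unfolding stabbable_def by blast
qed

section \<open>Families for four, five and six points\<close>

text \<open>Of four increasing points, cut on both sides of the second and before the fourth. Such a
  triple is determined by two positions.\<close>

lemma stabbable_4: "stabbable 4 n (n * n)"
proof -
  define Z where "Z = (\<lambda>(i, j). (i, Suc i, j)) ` ({..<n} \<times> {..<n})"
  have "card Z \<le> n * n"
    unfolding Z_def using card_image_le[of "{..<n} \<times> {..<n}"] by simp
  moreover have "\<exists>u\<in>Z. stabs u S" if S: "S \<subseteq> {..<n}" "4 \<le> card S" for S
  proof -
    define L where "L = sorted_list_of_set S"
    have "finite S" using S(1) finite_subset by blast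
    then have L: "sorted_wrt (<) L" "set L = S" "4 \<le> length L"
      using S(2) by (simp_all add: L_def)
    then have less: "L ! 0 < L ! 1" "L ! 1 < L ! 2" "L ! 2 < L ! 3"
      by (simp_all add: sorted_wrt_iff_nth_less)
    have mem: "L ! 0 \<in> S" "L ! 1 \<in> S" "L ! 2 \<in> S" "L ! 3 \<in> S"
      using L(3) unfolding L(2)[symmetric] by (auto intro!: nth_mem)
    have "stabs (L ! 1, Suc (L ! 1), L ! 3) S"
      by (rule stabsI[OF mem]) (use less in simp_all)
    moreover have "(L ! 1, Suc (L ! 1), L ! 3) \<in> Z"
      using mem S(1) unfolding Z_def by force
    ultimately show ?thesis by blast
  qed
  moreover have "finite Z" by (simp add: Z_def)
  ultimately show ?thesis unfolding stabbable_def by blast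
qed

text \<open>Halving: a set cannot meet three of two blocks, so the coarse family is empty and each
  of the \<open>i\<close> levels costs \<open>3 * n\<close>.\<close>

lemma stabbable_5: "n \<le> 2 ^ i \<Longrightarrow> stabbable 5 n (3 * i * n)"
proof (induction i arbitrary: n)
  case 0
  then show ?case using stabbable_small[of n 5] by simp
next
  case (Suc i)
  define t where "t = Suc n div 2"
  show ?case
  proof (cases "n = 0")
    case False
    have "stabbable (3 + 2) n (3 * i * n + 3 * n + 0)"
    proof (rule stabbable_step)
      show "0 < t" "n \<le> 2 * t" using False by (auto simp: t_def)
      show "stabbable (3 + 2) t' (3 * i * t')" if "t' \<le> t" for t'
        using Suc.IH[of t'] Suc.prems that by (simp add: t_def)
      show "stabbable 3 2 0" by (rule stabbable_small) simp
    qed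
    then show ?thesis by (simp add: algebra_simps)
  qed (use stabbable_small[of 0 5] in simp)
qed

text \<open>The square root rounded up. For \<open>t >= 2\<close>, the estimate
  \<open>(t - 1)^2 < n\<close> and \<open>t <= 2 * (t - 1)\<close> give the factor 4.\<close>

lemma ex_upper_square_root:
  fixes n :: nat
  obtains t where "n \<le> t * t" "t * t \<le> 4 * n" "\<And>T. n \<le> T * T \<Longrightarrow> t \<le> T"
proof -
  define t where "t = (LEAST t. n \<le> t * t)"
  have "n \<le> n * n" by (cases n) auto
  then have "n \<le> t * t" unfolding t_def by (rule LeastI)
  moreover have "t * t \<le> 4 * n"
  proof (cases "t \<le> 1")
    case True
    then have "t = 0 \<or> t = 1" by auto
    then show ?thesis
    proof
      assume "t = 1"
      then have "n \<noteq> 0" using not_less_Least[of 0 "\<lambda>t. n \<le> t * t"] unfolding t_def by fastforce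
      then show ?thesis using \<open>t = 1\<close> by simp
    qed simp
  next
    case False
    then obtain v where v: "t = Suc v" "1 \<le> v" by (cases t) auto
    then have "\<not> n \<le> v * v" using not_less_Least[of v "\<lambda>t. n \<le> t * t"] unfolding t_def by simp
    moreover have "v \<le> v * v" using v by simp
    moreover have "t * t = v * v + 2 * v + 1" using v by simp
    ultimately show ?thesis by linarith
  qed
  moreover have "t \<le> T" if "n \<le> T * T" for T
    unfolding t_def using that by (rule Least_le)
  ultimately show ?thesis by (rule that)
qed

text \<open>With \<open>t\<close> blocks of size \<open>t\<close> near the square root of
  \<open>n\<close>, the quadratic coarse family costs at most \<open>4 * n\<close>, so a level costs
  \<open>7 * n\<close>. Each level takes a square root, lowering \<open>i\<close> by one.\<close>

lemma stabbable_6: "n \<le> 2 ^ 2 ^ i \<Longrightarrow> stabbable 6 n (7 * i * n)"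
proof (induction i arbitrary: n)
  case 0
  then show ?case using stabbable_small[of n 6] by simp
next
  case (Suc i)
  show ?case
  proof (cases "n = 0")
    case False
    obtain t where t: "n \<le> t * t" "t * t \<le> 4 * n" "\<And>T. n \<le> T * T \<Longrightarrow> t \<le> T"
      using ex_upper_square_root[of n] by metis
    have "t \<le> 2 ^ 2 ^ i"
      using Suc.prems by (intro t(3)) (simp add: power_add[symmetric] mult_2)
    have "stabbable (4 + 2) n (7 * i * n + 3 * n + t * t)"
    proof (rule stabbable_step)
      show "0 < t" using t(1) False by (cases t) auto
      show "n \<le> t * t" by (fact t(1))
      show "stabbable (4 + 2) t' (7 * i * t')" if "t' \<le> t" for t'
        using Suc.IH[of t'] \<open>t \<le> 2 ^ 2 ^ i\<close> that by simp
      show "stabbable 4 t (t * t)" by (rule stabbable_4)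
    qed
    then show ?thesis
      by (rule stabbable_mono) (use t(2) in \<open>auto simp: algebra_simps\<close>)
  qed (use stabbable_small[of 0 6] in simp)
qed

section \<open>The inverse Ackermann hierarchy\<close>

text \<open>Growth guarantees that the least number in \<open>inverse_ack\<close> exists at every
  level from 1 on. The case \<open>n = 0\<close> is excluded because
  \<open>ack 1 0 = 0\<close>.\<close>

lemma Suc_le_ack: "1 \<le> n \<Longrightarrow> Suc n \<le> ack (Suc d) n"
proof (induction d arbitrary: n)
  case (Suc d)
  have "Suc n \<le> ack (Suc (Suc d)) n" for n
  proof (induction n)
    case (Suc n)
    then show ?case using Suc.IH \<open>\<And>n. 1 \<le> n \<Longrightarrow> Suc n \<le> ack (Suc d) n\<close>[of "ack (Suc (Suc d)) n"]
      by simp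
  qed simp
  then show ?case .
qed simp

lemma le_ack: "n \<le> ack (Suc d) n"
  using Suc_le_ack[of n d] by (cases n) auto

lemma le_ack_inverse_ack: "x \<le> ack (Suc d) (inverse_ack (Suc d) x)"
  unfolding inverse_ack_def by (rule LeastI) (rule le_ack)

lemma inverse_ack_le: "x \<le> ack d n \<Longrightarrow> inverse_ack d x \<le> n"
  unfolding inverse_ack_def by (rule Least_le)

lemma ack_2: "ack 2 n = 2 ^ n"
  by (induction n) (simp_all add: numeral_2_eq_2)

text \<open>Blocks of size \<open>\<alpha>\<^sub>d(n)\<close> make the coarse family linear in n.\<close>
lemma stabbable_ack_step:
  assumes "\<And>n. stabbable k n (C * n * inverse_ack (Suc d) n)"
  shows "n \<le> ack (Suc (Suc d)) i \<Longrightarrow> stabbable (k + 2) n ((2 * C + 3) * i * n)"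
proof (induction i arbitrary: n)
  case 0
  then show ?case using stabbable_small[of n "k + 2"] by simp
next
  case (Suc i)
  show ?case
  \<comment> \<open>For \<open>n <= 1\<close> the inverse may be 0, which is no block size; but then
    no set has \<open>k + 2\<close> points.\<close>
  proof (cases "n \<le> 1")
    case True
    then show ?thesis using stabbable_small[of n "k + 2"] stabbable_mono by fastforce
  next
    case False
    define t where "t = inverse_ack (Suc d) n"
    define q where "q = (n + t - 1) div t"
    have n_le: "n \<le> ack (Suc d) t" unfolding t_def by (rule le_ack_inverse_ack)
    have "0 < t"
    proof (rule ccontr)
      assume "\<not> 0 < t"
      moreover have "ack (Suc d) 0 \<le> 1" by (cases d) auto
      ultimately show False using n_le False by simp
    qed
    have "t \<le> n" unfolding t_def by (rule inverse_ack_le) (rule le_ack)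
    have q: "n \<le> q * t" "q * t \<le> 2 * n"
    proof -
      have "q * t + (n + t - 1) mod t = n + t - 1" unfolding q_def by (rule div_mult_mod_eq)
      moreover have "(n + t - 1) mod t < t" using \<open>0 < t\<close> by simp
      ultimately show "n \<le> q * t" "q * t \<le> 2 * n" using \<open>0 < t\<close> \<open>t \<le> n\<close> by linarith+
    qed
    have "q \<le> n"
    proof -
      have "n + t - 1 \<le> n * t" using \<open>0 < t\<close> False by (cases t; cases n) auto
      then show ?thesis unfolding q_def using \<open>0 < t\<close>
        by (metis div_le_mono div_mult_self_is_m)
    qed
    have "stabbable (k + 2) n ((2 * C + 3) * i * n + 3 * n + 2 * C * n)"
    proof (rule stabbable_step)
      show "0 < t" "n \<le> q * t" by fact+
      show "stabbable (k + 2) t' ((2 * C + 3) * i * t')" if "t' \<le> t" for t'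
      proof (rule Suc.IH)
        \<comment> \<open>By the recursion, \<open>n\<close> is at most \<open>ack (Suc d)\<close>
          of \<open>ack (Suc (Suc d)) i\<close>. So passing from \<open>n\<close> to
          \<open>t\<close> lowers \<open>i\<close> by one.\<close>
        have "t \<le> ack (Suc (Suc d)) i"
          unfolding t_def using Suc.prems by (intro inverse_ack_le) simp
        then show "t' \<le> ack (Suc (Suc d)) i" using that by simp
      qed
      \<comment> \<open>From \<open>q <= n\<close> the coarse cost is at most
        \<open>C * q * t\<close>, hence at most \<open>2 * C * n\<close>. Adding
        \<open>3 * n\<close> gives the constant \<open>2 * C + 3\<close> per level.\<close>
      have "inverse_ack (Suc d) q \<le> t"
        using n_le \<open>q \<le> n\<close> by (intro inverse_ack_le) simp
      then have "q * inverse_ack (Suc d) q \<le> 2 * n"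
        using q(2) by (meson le_refl mult_le_mono order_trans)
      then have "C * q * inverse_ack (Suc d) q \<le> 2 * C * n"
        by (metis mult.assoc mult.left_commute mult_le_mono2)
      then show "stabbable k q (2 * C * n)"
        using assms[of q] by (rule stabbable_mono[rotated 2]) simp
    qed
    then show ?thesis by (simp add: algebra_simps)
  qed
qed

text \<open>Two more occurrences raise the index of the inverse by one. The start is
  \<open>stabbable_5\<close>, as \<open>ack 2\<close> is the power of two.\<close>

lemma stabbable_inverse_ack:
  "\<exists>C. \<forall>n. stabbable (2 * d + 5) n (C * n * inverse_ack (d + 2) n)"
proof (induction d)
  case 0
  have "stabbable 5 n (3 * n * inverse_ack 2 n)" for n
    using stabbable_5[of n "inverse_ack 2 n"] le_ack_inverse_ack[of n 1]
    by (simp add: ack_2 numeral_2_eq_2[symmetric] mult_ac)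
  then show ?case by (intro exI[of _ 3] allI) (simp add: numeral_2_eq_2)
next
  case (Suc d)
  then obtain C where "\<And>n. stabbable (2 * d + 5) n (C * n * inverse_ack (Suc (Suc d)) n)"
    by auto
  from stabbable_ack_step[OF this le_ack_inverse_ack]
  have "stabbable (2 * Suc d + 5) n ((2 * C + 3) * n * inverse_ack (Suc d + 2) n)" for n
    by (simp add: mult_ac add_ac)
  then show ?case by blast
qed

section \<open>Asymptotics\<close>

text \<open>Finiteness accompanies the estimate because \<open>the_enat\<close> carries no
  information at infinity.\<close>

lemma max_letters_bigo:
  assumes "\<And>m. stabbable k m (N m)" "(\<lambda>m. real (N m)) \<in> O(g)"
  shows "(\<forall>m\<ge>1. max_letters 5 k m \<noteq> \<infinity>) \<and> (\<lambda>m. real (the_enat (max_letters 5 k m))) \<in> O(g)"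
proof
  have le: "max_letters 5 k m \<le> enat (N m)" for m
    by (rule max_letters_le_stabbable) (rule assms)
  then show "\<forall>m\<ge>1. max_letters 5 k m \<noteq> \<infinity>"
    by (metis enat_ord_simps(5) infinity_ileE)
  have "the_enat (max_letters 5 k m) \<le> N m" for m
    using le[of m] by (cases "max_letters 5 k m") auto
  then have "(\<lambda>m. real (the_enat (max_letters 5 k m))) \<in> O(\<lambda>m. real (N m))"
    by (intro landau_o.big_mono) auto
  then show "(\<lambda>m. real (the_enat (max_letters 5 k m))) \<in> O(g)"
    using assms(2) by (rule landau_o.big_trans)
qed

lemma max_letters_5_5:
  "(\<forall>m\<ge>1. max_letters 5 5 m \<noteq> \<infinity>) \<and>
   (\<lambda>m. real (the_enat (max_letters 5 5 m))) \<in> O(\<lambda>m. real m * ln (real m))"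
proof (rule max_letters_bigo)
  define i where "i m = nat \<lceil>log 2 (real m)\<rceil>" for m :: nat
  show "stabbable 5 m (3 * i m * m)" for m
  proof (rule stabbable_5)
    show "m \<le> 2 ^ i m"
    proof (cases "m = 0")
      case False
      have "log 2 (real m) \<le> real (i m)" unfolding i_def by linarith
      then have "real m \<le> 2 powr real (i m)" using False by (simp add: log_le_iff)
      then have "real m \<le> real (2 ^ i m)" by (simp add: powr_realpow)
      then show ?thesis by linarith
    qed simp
  qed
  have "(\<lambda>m. real (3 * i m * m)) \<in> O(\<lambda>m. 3 * (log 2 (real m) + 1) * real m)"
  proof (rule landau_o.big_mono)
    show "eventually (\<lambda>m. norm (real (3 * i m * m)) \<le> norm (3 * (log 2 (real m) + 1) * real m)) at_top"
      using eventually_ge_at_top[of 1]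
    proof eventually_elim
      case (elim m)
      then have "0 \<le> log 2 (real m)" by simp
      then have "real (i m) \<le> log 2 (real m) + 1" unfolding i_def by linarith
      then show ?case using \<open>0 \<le> log 2 (real m)\<close> by (simp add: abs_mult mult_right_mono)
    qed
  qed
  also have "(\<lambda>m. 3 * (log 2 (real m) + 1) * real m) \<in> O(\<lambda>m. real m * ln (real m))"
    by real_asymp
  finally show "(\<lambda>m. real (3 * i m * m)) \<in> O(\<lambda>m. real m * ln (real m))" .
qed

lemma max_letters_5_6:
  "(\<forall>m\<ge>1. max_letters 5 6 m \<noteq> \<infinity>) \<and>
   (\<lambda>m. real (the_enat (max_letters 5 6 m))) \<in> O(\<lambda>m. real m * ln (ln (real m)))"
proof (rule max_letters_bigo)
  define i where "i m = nat \<lceil>log 2 (log 2 (real m))\<rceil>" for m :: nat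
  show "stabbable 6 m (7 * i m * m)" for m
  proof (rule stabbable_6)
    show "m \<le> 2 ^ 2 ^ i m"
    proof (cases "m \<le> 1")
      case False
      have pos: "0 < log 2 (real m)" using False by simp
      have "log 2 (log 2 (real m)) \<le> real (i m)" unfolding i_def by linarith
      then have "log 2 (real m) \<le> 2 powr real (i m)" using pos by (simp add: log_le_iff)
      then have "log 2 (real m) \<le> real (2 ^ i m)" by (simp add: powr_realpow)
      then have "real m \<le> 2 powr real (2 ^ i m)" using False by (simp add: log_le_iff)
      then have "real m \<le> real (2 ^ 2 ^ i m)" by (simp only: powr_realpow) simp
      then show ?thesis by linarith
    next
      case True
      then show ?thesis using one_le_power[of "2::nat" "2 ^ i m"] by linarith
    qed
  qed
  have "(\<lambda>m. real (7 * i m * m)) \<in> O(\<lambda>m. 7 * (log 2 (log 2 (real m)) + 1) * real m)"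
  proof (rule landau_o.big_mono)
    show "eventually (\<lambda>m. norm (real (7 * i m * m))
        \<le> norm (7 * (log 2 (log 2 (real m)) + 1) * real m)) at_top"
      using eventually_ge_at_top[of 2]
    proof eventually_elim
      case (elim m)
      then have "1 \<le> log 2 (real m)" by (simp add: le_log_iff)
      then have "0 \<le> log 2 (log 2 (real m))" by simp
      then have "real (i m) \<le> log 2 (log 2 (real m)) + 1" unfolding i_def by linarith
      then show ?case
        using \<open>0 \<le> log 2 (log 2 (real m))\<close> by (simp add: abs_mult mult_right_mono)
    qed
  qed
  also have "(\<lambda>m. 7 * (log 2 (log 2 (real m)) + 1) * real m) \<in> O(\<lambda>m. real m * ln (ln (real m)))"
    by real_asymp
  finally show "(\<lambda>m. real (7 * i m * m)) \<in> O(\<lambda>m. real m * ln (ln (real m)))" .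
qed

lemma max_letters_5_ge_5:
  assumes "5 \<le> k"
  shows "(\<forall>m\<ge>1. max_letters 5 k m \<noteq> \<infinity>) \<and>
   (\<lambda>m. real (the_enat (max_letters 5 k m))) \<in> O(\<lambda>m. real m * real (inverse_ack ((k - 1) div 2) m))"
proof -
  \<comment> \<open>For even \<open>k\<close> the family for \<open>k - 1 = 2 * d + 5\<close>
    serves, by \<open>stabbable_mono\<close>.\<close>
  obtain d where d: "(k - 1) div 2 = d + 2" "2 * d + 5 \<le> k"
    using assms by (intro that[of "(k - 1) div 2 - 2"]) auto
  obtain C where "\<And>n. stabbable (2 * d + 5) n (C * n * inverse_ack (d + 2) n)"
    using stabbable_inverse_ack by blast
  then show ?thesis
    unfolding d(1) using d(2)
    by (intro max_letters_bigo[where N = "\<lambda>n. C * n * inverse_ack (d + 2) n"])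
      (auto intro: stabbable_mono simp: mult.assoc)
qed

theorem corollary2p3:
  "(\<forall>s m :: nat. 2 \<le> s \<longrightarrow> 1 \<le> m \<longrightarrow>
      max_letters (s + 1) s m \<le> enat ((m - nat \<lceil>real s / 2\<rceil>) choose nat \<lfloor>real s / 2\<rfloor>))
   \<and> ((\<forall>m\<ge>1. max_letters 5 5 m \<noteq> \<infinity>) \<and>
      (\<lambda>m. real (the_enat (max_letters 5 5 m))) \<in> O(\<lambda>m. real m * ln (real m)))
   \<and> ((\<forall>m\<ge>1. max_letters 5 6 m \<noteq> \<infinity>) \<and>
      (\<lambda>m. real (the_enat (max_letters 5 6 m))) \<in> O(\<lambda>m. real m * ln (ln (real m))))
   \<and> (\<forall>k\<ge>7. (\<forall>m\<ge>1. max_letters 5 k m \<noteq> \<infinity>) \<and>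
      (\<lambda>m. real (the_enat (max_letters 5 k m)))
        \<in> O(\<lambda>m. real m * real (inverse_ack ((k - 1) div 2) m)))"
proof -
  have "max_letters (s + 1) s m \<le> enat ((m - nat \<lceil>real s / 2\<rceil>) choose nat \<lfloor>real s / 2\<rfloor>)"
    if "2 \<le> s" for s m
  proof -
    have "nat \<lfloor>real s / 2\<rfloor> = s div 2" "nat \<lceil>real s / 2\<rceil> = s - s div 2"
      by linarith+
    then show ?thesis using max_letters_le_binomial[OF that] by simp
  qed
  then show ?thesis
    using max_letters_5_5 max_letters_5_6 max_letters_5_ge_5 by simp
qed

end
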